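(* Let $\{U(t)\}_{t\in\mathbb{R}}$ be a $C_0$-group on a complex Banach space $\mathfrak{X}$ with generator $iA$, satisfying $\int_{-\infty}^{\infty}\frac{\ln\|U(t)\|}{1+t^2}\,dt<\infty$. Then for every $n\in\mathbb{N}$ there is a constant $c_n>0$ such that for every $\alpha\ge1$ and every exponential type entire vector $x\in\mathfrak{E}(A)$ of type $\sigma(x,A)\le\alpha$, $$\|A^nx\|\le c_n\alpha^n\|x\|.$$ (The constants $c_n$ do not depend on $x$ and on $\alpha$.)
   Context: Setting: $(\mathfrak{X},\|\cdot\|)$ is a complex Banach space, $A$ is a closed densely defined linear operator with domain $\mathcal{D}(A)$, and $iA$ generates the strongly continuous group $\{U(t)\}_{t\in\mathbb{R}}$; the integral condition means that $\ln\|U(t)\|/(1+t^2)$ is Lebesgue integrable on $\mathbb{R}$. Here $\mathbb{N}_0=\mathbb{N}\cup\{0\}$. Definitions: $C^\infty(A)=\bigcap_{n\in\mathbb{N}_0}\mathcal{D}(A^n)$; for $\alpha>0$, $\mathfrak{E}^{\alpha}(A)=\{x\in C^\infty(A): \exists c=c(x)>0\ \forall k\in\mathbb{N}_0\ \|A^kx\|\le c\alpha^k\}$; $\mathfrak{E}(A)=\bigcup_{\alpha>0}\mathfrak{E}^\alpha(A)$ (exponential type entire vectors of $A$). The type of $x\in\mathfrak{E}(A)$ is $\sigma(x,A)=\inf\{\alpha>0: x\in\mathfrak{E}^\alpha(A)\}=\limsup_{n\to\infty}\|A^nx\|^{1/n}$. *)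

theory Defs
  imports "HOL-Analysis.Analysis"
begin

class scaleC =
  fixes scaleC :: "complex \<Rightarrow> 'a \<Rightarrow> 'a" (infixr "*\<^sub>C" 75)

(* The real structure of banach is required to be the restriction of the complex one,
   so that onorm, closed, closure and limits can be taken from the library. *)
class complex_banach = banach + scaleC +
  assumes scaleC_add_right: "c *\<^sub>C (x + y) = c *\<^sub>C x + c *\<^sub>C y"
    and scaleC_add_left: "(c + d) *\<^sub>C x = c *\<^sub>C x + d *\<^sub>C x"
    and scaleC_scaleC: "c *\<^sub>C d *\<^sub>C x = (c * d) *\<^sub>C x"
    and scaleR_scaleC: "r *\<^sub>R x = complex_of_real r *\<^sub>C x"
    and norm_scaleC: "norm (c *\<^sub>C x) = cmod c * norm x"

instantiation complex :: complex_banach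
begin

definition scaleC_complex :: "complex \<Rightarrow> complex \<Rightarrow> complex" where
  "scaleC_complex c x = c * x"

instance
  by standard (auto simp: scaleC_complex_def algebra_simps norm_mult scaleR_conv_of_real)

end

definition bounded_clinear :: "('a::complex_banach \<Rightarrow> 'a) \<Rightarrow> bool" where
  "bounded_clinear f \<longleftrightarrow> bounded_linear f \<and> (\<forall>c x. f (c *\<^sub>C x) = c *\<^sub>C f x)"

(* An unbounded operator is a pair of a domain D and a total function A;
   the values of A outside D are irrelevant. *)

definition clinear_op :: "'a::complex_banach set \<Rightarrow> ('a \<Rightarrow> 'a) \<Rightarrow> bool" where
  "clinear_op D A \<longleftrightarrow>
     0 \<in> D \<and>
     (\<forall>x\<in>D. \<forall>y\<in>D. x + y \<in> D \<and> A (x + y) = A x + A y) \<and>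
     (\<forall>c. \<forall>x\<in>D. c *\<^sub>C x \<in> D \<and> A (c *\<^sub>C x) = c *\<^sub>C A x)"

definition closed_op :: "'a::complex_banach set \<Rightarrow> ('a \<Rightarrow> 'a) \<Rightarrow> bool" where
  "closed_op D A \<longleftrightarrow> closed {(x, A x) |x. x \<in> D}"

definition densely_defined :: "'a::complex_banach set \<Rightarrow> bool" where
  "densely_defined D \<longleftrightarrow> closure D = UNIV"

definition C0_group :: "(real \<Rightarrow> 'a::complex_banach \<Rightarrow> 'a) \<Rightarrow> bool" where
  "C0_group U \<longleftrightarrow>
     (\<forall>t. bounded_clinear (U t)) \<and>
     U 0 = id \<and>
     (\<forall>s t. U (s + t) = U s \<circ> U t) \<and>
     (\<forall>x. ((\<lambda>t. U t x) \<longlongrightarrow> x) (at 0))"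

definition is_generator ::
    "(real \<Rightarrow> 'a::complex_banach \<Rightarrow> 'a) \<Rightarrow> 'a set \<Rightarrow> ('a \<Rightarrow> 'a) \<Rightarrow> bool" where
  "is_generator U D B \<longleftrightarrow>
     D = {x. \<exists>y. ((\<lambda>h. (U h x - x) /\<^sub>R h) \<longlongrightarrow> y) (at 0)} \<and>
     (\<forall>x\<in>D. ((\<lambda>h. (U h x - x) /\<^sub>R h) \<longlongrightarrow> B x) (at 0))"

(* The domain of the n-th power of (D, A); on it that power is A ^^ n. *)
fun dom_pow :: "'a set \<Rightarrow> ('a \<Rightarrow> 'a) \<Rightarrow> nat \<Rightarrow> 'a set" where
  "dom_pow D A 0 = UNIV"
| "dom_pow D A (Suc n) = {x \<in> dom_pow D A n. (A ^^ n) x \<in> D}"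

definition C_infinity :: "'a set \<Rightarrow> ('a \<Rightarrow> 'a) \<Rightarrow> 'a set" where
  "C_infinity D A = (\<Inter>n. dom_pow D A n)"

definition exp_type_vectors_le ::
    "'a::complex_banach set \<Rightarrow> ('a \<Rightarrow> 'a) \<Rightarrow> real \<Rightarrow> 'a set" where
  "exp_type_vectors_le D A \<alpha> =
     {x \<in> C_infinity D A. \<exists>c>0. \<forall>k. norm ((A ^^ k) x) \<le> c * \<alpha> ^ k}"

definition exp_type_vectors :: "'a::complex_banach set \<Rightarrow> ('a \<Rightarrow> 'a) \<Rightarrow> 'a set" where
  "exp_type_vectors D A = (\<Union>\<alpha>\<in>{0<..}. exp_type_vectors_le D A \<alpha>)"

definition exp_type :: "'a::complex_banach set \<Rightarrow> ('a \<Rightarrow> 'a) \<Rightarrow> 'a \<Rightarrow> real" where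
  "exp_type D A x = Inf {\<alpha>. 0 < \<alpha> \<and> x \<in> exp_type_vectors_le D A \<alpha>}"

end

theory Submission
  imports Defs "HOL-Complex_Analysis.Complex_Analysis"
begin

text \<open>
  Let \<open>x\<close> be an entire vector with \<open>\<parallel>A\<^sup>k x\<parallel> \<le> c \<beta>\<^sup>k\<close> for all \<open>k\<close>, where \<open>\<beta> = 2 \<alpha>\<close> exceeds the type of \<open>x\<close>.
  The orbit \<open>U t x\<close> is then the restriction to the real line of the entire function
  \<open>\<Sum>k. (i z)\<^sup>k / k! \<cdot> A\<^sup>k x\<close>, whose \<open>n\<close>-th derivative at \<open>0\<close> is \<open>i\<^sup>n A\<^sup>n x\<close>. So it is enough to bound
  this function by a multiple of \<open>\<parallel>x\<parallel>\<close>, independent of \<open>x\<close> and \<open>\<alpha>\<close>, on the disc of radius \<open>1 / \<beta>\<close>: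
  the Cauchy inequality then yields \<open>\<parallel>A\<^sup>n x\<parallel> \<le> n! \<cdot> const \<cdot> \<beta>\<^sup>n \<cdot> \<parallel>x\<parallel>\<close>. A norming functional (lemma
  \<open>norming_functional\<close>, a form of the Hahn--Banach theorem) reduces this to a scalar entire
  function \<open>g\<close>.

  What is known about \<open>g\<close> is \<open>\<bar>g z\<bar> \<le> c exp (\<beta> \<bar>z\<bar>)\<close>, where \<open>c\<close> depends on \<open>x\<close> in an uncontrolled way,
  and \<open>\<bar>g t\<bar> \<le> \<parallel>U t\<parallel> \<parallel>x\<parallel>\<close> on the real line. Classically, a function of exponential type \<open>\<sigma>\<close> satisfies
  \<open>ln \<bar>g z\<bar> \<le> \<sigma> \<bar>Im z\<bar> + P z\<close> where \<open>P\<close> is the Poisson integral of any majorant of \<open>ln \<bar>g t\<bar>\<close> on the line;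
  the Poisson integral of \<open>ln \<parallel>U t\<parallel>\<close> converges by hypothesis, and \<open>\<sigma> \<bar>Im z\<bar> \<le> 1\<close> on the disc, so the
  constant \<open>c\<close> has disappeared from the bound.

  This inequality is used here in a discrete form with worse constants. The function
  \<open>t \<mapsto> ln \<parallel>U t\<parallel>\<close> is subadditive, and averaging \<open>ln \<parallel>U t\<parallel> \<le> ln \<parallel>U (t - s)\<parallel> + ln \<parallel>U s\<parallel>\<close> over
  \<open>s \<in> [0, 1]\<close> shows that integrability against \<open>1 / (1 + t\<^sup>2)\<close> already gives a step function majorant,
  constant on the intervals \<open>[n, n + 1)\<close>, with values \<open>w n\<close> such that \<open>\<Sum>n. w n / (1 + n\<^sup>2)\<close> converges
  (lemma \<open>subadditive_majorant\<close>). The Poisson integral is replaced by \<open>\<Sum>n. 2 w n\<close> times the Poisson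
  kernel of the half plane \<open>Im z > - 1\<close> with pole at \<open>n - i\<close>, which dominates \<open>w n\<close> on \<open>[n, n + 1]\<close>. In a
  half disc of radius \<open>R\<close> only finitely many of these terms matter, so the maximum modulus principle
  applies to \<open>g\<close> divided by the exponential of a rational function. On the arc the growth
  \<open>exp (\<beta> R)\<close> is absorbed by two more Poisson kernels with poles close to \<open>\<plusminus> R\<close>; near the origin these
  are of order \<open>1 / (\<beta> R\<^sup>2)\<close>, which makes their contribution bounded when \<open>R\<close> is large compared with
  \<open>ln c\<close> (lemmas \<open>exponential_type_half_plane_bound\<close> and \<open>exponential_type_disc_bound\<close>).
\<close>

section \<open>Norming functionals\<close>

text \<open>
  Linear functionals are obtained as the minimal elements among the sublinear ones. This keeps
  all functions total: no extension from a subspace takes place.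
\<close>

definition sublinear :: "('a::real_vector \<Rightarrow> real) \<Rightarrow> bool" where
  "sublinear p \<longleftrightarrow> (\<forall>x y. p (x + y) \<le> p x + p y) \<and> (\<forall>c>0. \<forall>x. p (c *\<^sub>R x) \<le> c * p x)"

lemma sublinear_add: "sublinear p \<Longrightarrow> p (x + y) \<le> p x + p y"
  by (simp add: sublinear_def)

lemma sublinear_scale_le: "sublinear p \<Longrightarrow> c > 0 \<Longrightarrow> p (c *\<^sub>R x) \<le> c * p x"
  by (simp add: sublinear_def)

lemma sublinear_zero:
  assumes "sublinear p" shows "p 0 = 0"
  using sublinear_scale_le[OF assms, of 2 0] sublinear_scale_le[OF assms, of "1/2" 0] by simp

lemma sublinear_scale:
  assumes p: "sublinear p" and c: "c \<ge> 0" shows "p (c *\<^sub>R x) = c * p x"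
proof (cases "c = 0")
  case True then show ?thesis using sublinear_zero[OF p] by simp
next
  case False
  with c have c: "c > 0" by simp
  have "p x \<le> p (c *\<^sub>R x) / c"
    using sublinear_scale_le[OF p, of "1/c" "c *\<^sub>R x"] c by simp
  then have "c * p x \<le> p (c *\<^sub>R x)" using c by (simp add: pos_le_divide_eq mult.commute)
  with sublinear_scale_le[OF p c, of x] show ?thesis by simp
qed

lemma sublinear_ge_neg:
  assumes p: "sublinear p" shows "- p (- x) \<le> p x"
  using sublinear_add[OF p, of x "- x"] sublinear_zero[OF p] by simp

text \<open>
  With \<open>t = 1 / s\<close> the terms become the difference quotients \<open>(p (y + s x) - p y) / s\<close>, so for
  sublinear \<open>p\<close> this is the one-sided derivative of \<open>p\<close> at \<open>y\<close> in direction \<open>x\<close>.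
\<close>

definition slide :: "('a::real_vector \<Rightarrow> real) \<Rightarrow> 'a \<Rightarrow> 'a \<Rightarrow> real" where
  "slide p y x = (INF t\<in>{0..}. p (x + t *\<^sub>R y) - t * p y)"

lemma slide_le:
  assumes p: "sublinear p" and t: "t \<ge> 0"
  shows "slide p y x \<le> p (x + t *\<^sub>R y) - t * p y"
proof -
  have "- p (- x) \<le> p (x + t *\<^sub>R y) - t * p y" if "t \<ge> 0" for t
    using sublinear_add[OF p, of "x + t *\<^sub>R y" "- x"] sublinear_scale[OF p that, of y] by simp
  then have "bdd_below ((\<lambda>t. p (x + t *\<^sub>R y) - t * p y) ` {0..})"
    by (intro bdd_belowI2[where m = "- p (- x)"]) auto
  then show ?thesis
    unfolding slide_def by (rule cINF_lower) (use t in auto)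
qed

lemma slide_greatest:
  assumes "\<And>t. t \<ge> 0 \<Longrightarrow> m \<le> p (x + t *\<^sub>R y) - t * p y"
  shows "m \<le> slide p y x"
  unfolding slide_def by (rule cINF_greatest) (use assms in auto)

lemma sublinear_slide:
  assumes p: "sublinear p" shows "sublinear (slide p y)"
  unfolding sublinear_def
proof (intro conjI allI impI)
  fix u v
  have "slide p y (u + v) - (p (v + t *\<^sub>R y) - t * p y) \<le> slide p y u" if t: "t \<ge> 0" for t
  proof (rule slide_greatest)
    fix s :: real assume s: "s \<ge> 0"
    have "slide p y (u + v) \<le> p ((u + s *\<^sub>R y) + (v + t *\<^sub>R y)) - (s + t) * p y"
      using slide_le[OF p, of "s + t" y "u + v"] s t by (simp add: algebra_simps)
    then show "slide p y (u + v) - (p (v + t *\<^sub>R y) - t * p y) \<le> p (u + s *\<^sub>R y) - s * p y"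
      using sublinear_add[OF p, of "u + s *\<^sub>R y" "v + t *\<^sub>R y"] by (simp add: algebra_simps)
  qed
  then have "slide p y (u + v) - slide p y u \<le> slide p y v"
    by (intro slide_greatest) (smt (verit))
  then show "slide p y (u + v) \<le> slide p y u + slide p y v" by simp
next
  fix c :: real and x assume c: "c > 0"
  have "slide p y (c *\<^sub>R x) / c \<le> slide p y x"
  proof (rule slide_greatest)
    fix t :: real assume t: "t \<ge> 0"
    have "slide p y (c *\<^sub>R x) \<le> p (c *\<^sub>R (x + t *\<^sub>R y)) - (c * t) * p y"
      using slide_le[OF p, of "c * t" y "c *\<^sub>R x"] c t by (simp add: algebra_simps)
    also have "\<dots> = c * (p (x + t *\<^sub>R y) - t * p y)"
      using sublinear_scale[OF p, of c "x + t *\<^sub>R y"] c by (simp only: right_diff_distrib mult.assoc)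
    finally show "slide p y (c *\<^sub>R x) / c \<le> p (x + t *\<^sub>R y) - t * p y"
      using c by (simp add: pos_divide_le_eq mult.commute)
  qed
  then show "slide p y (c *\<^sub>R x) \<le> c * slide p y x"
    using c by (simp add: pos_divide_le_eq mult.commute)
qed

text \<open>
  A pointwise infimum of sublinear functionals need not be subadditive. Along a chain it is,
  because two members of the chain can be replaced by the smaller one. The inequality
  \<open>- p (- x) \<le> p x\<close> turns the common upper bound \<open>p0\<close> into a lower bound, so that the infimum is finite.
\<close>

lemma sublinear_INF_chain:
  fixes C :: "('a::real_vector \<Rightarrow> real) set"
  assumes ne: "C \<noteq> {}" and sub: "\<And>p. p \<in> C \<Longrightarrow> sublinear p"
    and bound: "\<And>p. p \<in> C \<Longrightarrow> p \<le> p0"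
    and chain: "\<And>p q. p \<in> C \<Longrightarrow> q \<in> C \<Longrightarrow> p \<le> q \<or> q \<le> p"
  shows "sublinear (\<lambda>x. INF p\<in>C. p x)" and "\<And>p. p \<in> C \<Longrightarrow> (\<lambda>x. INF p\<in>C. p x) \<le> p"
proof -
  define q where "q x = (INF p\<in>C. p x)" for x
  have lower: "q x \<le> p x" if "p \<in> C" for p x
  proof -
    have "- p0 (- x) \<le> p x" if "p \<in> C" for p
      using sublinear_ge_neg[OF sub[OF that], of x] bound[OF that] by (smt (verit) le_funD)
    then have "bdd_below ((\<lambda>p. p x) ` C)" by (rule bdd_belowI2)
    then show ?thesis unfolding q_def using that by (rule cINF_lower)
  qed
  have greatest: "m \<le> q x" if "\<And>p. p \<in> C \<Longrightarrow> m \<le> p x" for m x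
    unfolding q_def using ne that by (rule cINF_greatest)
  show "(\<lambda>x. INF p\<in>C. p x) \<le> p" if "p \<in> C" for p
    using lower[OF that] by (simp add: le_fun_def q_def)
  have "sublinear q"
    unfolding sublinear_def
  proof (intro conjI allI impI)
    fix u v
    have "q (u + v) \<le> p1 u + p2 v" if C: "p1 \<in> C" "p2 \<in> C" for p1 p2
    proof -
      obtain p where p: "p \<in> C" "p \<le> p1" "p \<le> p2"
        using chain[OF C] C by blast
      have "q (u + v) \<le> p u + p v"
        using lower[OF p(1), of "u + v"] sublinear_add[OF sub[OF p(1)], of u v] by simp
      with p(2,3) show ?thesis by (meson add_mono le_funD order_trans)
    qed
    then have "q (u + v) - p2 v \<le> q u" if "p2 \<in> C" for p2
      using that by (intro greatest) (smt (verit))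
    then have "q (u + v) - q u \<le> q v"
      by (intro greatest) (smt (verit))
    then show "q (u + v) \<le> q u + q v" by simp
  next
    fix c :: real and x assume c: "c > 0"
    have "q (c *\<^sub>R x) / c \<le> q x"
    proof (rule greatest)
      fix p assume p: "p \<in> C"
      have "q (c *\<^sub>R x) \<le> c * p x"
        using lower[OF p, of "c *\<^sub>R x"] sublinear_scale_le[OF sub[OF p] c, of x] by simp
      then show "q (c *\<^sub>R x) / c \<le> p x" using c by (simp add: pos_divide_le_eq mult.commute)
    qed
    then show "q (c *\<^sub>R x) \<le> c * q x" using c by (simp add: pos_divide_le_eq mult.commute)
  qed
  then show "sublinear (\<lambda>x. INF p\<in>C. p x)" by (simp add: q_def[abs_def])
qed

lemma minimal_sublinear_exists:
  fixes p0 :: "'a::real_vector \<Rightarrow> real"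
  assumes p0: "sublinear p0"
  obtains p where "sublinear p" "p \<le> p0" "\<And>q. sublinear q \<Longrightarrow> q \<le> p \<Longrightarrow> q = p"
proof -
  let ?A = "{p. sublinear p \<and> p \<le> p0}"
  have "partial_order_on ?A (relation_of (\<ge>) ?A)"
    by (auto simp: partial_order_on_def preorder_on_def refl_on_def trans_def antisym_def
        relation_of_def)
  moreover have "\<exists>u\<in>?A. \<forall>p\<in>C. u \<le> p" if C: "C \<in> Chains (relation_of (\<ge>) ?A)" for C
  proof (cases "C = {}")
    case True
    then show ?thesis using p0 by auto
  next
    case False
    have C': "p \<le> q \<or> q \<le> p" "p \<in> ?A" if "p \<in> C" "q \<in> C" for p q
      using C that by (auto simp: Chains_def relation_of_def)
    let ?q = "\<lambda>x. INF p\<in>C. p x"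
    have "sublinear ?q" "\<And>p. p \<in> C \<Longrightarrow> ?q \<le> p"
      using sublinear_INF_chain[OF False, of p0] C' by blast+
    moreover obtain p where "p \<in> C" using False by blast
    ultimately have "?q \<in> ?A" using C'(2) by (blast intro: order_trans)
    then show ?thesis using \<open>\<And>p. p \<in> C \<Longrightarrow> ?q \<le> p\<close> by blast
  qed
  ultimately obtain p where "p \<in> ?A" "\<forall>q\<in>?A. q \<le> p \<longrightarrow> q = p"
    using predicate_Zorn[of ?A "(\<ge>)"] by blast
  then show thesis by (intro that[of p]) (auto intro: order_trans)
qed

text \<open>
  By minimality \<open>slide p y = p\<close>, and the term with parameter \<open>1\<close> in the infimum that defines
  \<open>slide p y x\<close> is \<open>p (x + y) - p y\<close>. This gives the superadditivity of \<open>p\<close>.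
\<close>

lemma minimal_sublinear_linear:
  assumes p: "sublinear p" and min: "\<And>q. sublinear q \<Longrightarrow> q \<le> p \<Longrightarrow> q = p"
  shows "linear p"
proof -
  have "p x + p y = p (x + y)" for x y
  proof -
    have "slide p y \<le> p"
      using slide_le[OF p, of 0 y] by (simp add: le_fun_def)
    then have "slide p y = p" by (intro min sublinear_slide p)
    then have "p x \<le> p (x + y) - p y"
      using slide_le[OF p, of 1 y x] by simp
    then show ?thesis using sublinear_add[OF p, of x y] by simp
  qed
  note add = this
  have neg: "p (- x) = - p x" for x
    using add[of x "- x"] sublinear_zero[OF p] by simp
  have "p (c *\<^sub>R x) = c * p x" for c x
  proof (cases "c \<ge> 0")
    case True then show ?thesis by (rule sublinear_scale[OF p])
  next
    case False
    then show ?thesis using sublinear_scale[OF p, of "- c" x] neg[of "c *\<^sub>R x"] by simp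
  qed
  then show ?thesis using add by (intro linearI) auto
qed

text \<open>
  Below \<open>slide norm x0\<close>, rather than below the norm itself, every linear \<open>p\<close> satisfies
  \<open>p (- x0) \<le> \<parallel>- x0 + x0\<parallel> - \<parallel>x0\<parallel>\<close>, which forces \<open>p x0 = \<parallel>x0\<parallel>\<close>.
\<close>

lemma norming_functional:
  fixes x0 :: "'a::real_normed_vector"
  obtains \<psi> :: "'a \<Rightarrow> real"
  where "bounded_linear \<psi>" "\<And>x. \<bar>\<psi> x\<bar> \<le> norm x" "\<psi> x0 = norm x0"
proof -
  have nrm: "sublinear (norm :: 'a \<Rightarrow> real)"
    by (auto simp: sublinear_def norm_triangle_ineq)
  obtain p where p: "sublinear p" "p \<le> slide norm x0"
    and min: "\<And>q. sublinear q \<Longrightarrow> q \<le> p \<Longrightarrow> q = p"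
    using minimal_sublinear_exists[OF sublinear_slide[OF nrm, of x0]] by metis
  interpret linear p by (rule minimal_sublinear_linear[OF p(1) min])
  have le: "p x \<le> norm x" for x
    using slide_le[OF nrm, of 0 x0 x] le_funD[OF p(2), of x] by simp
  have "p (- x0) \<le> - norm x0"
    using slide_le[OF nrm, of 1 x0 "- x0"] le_funD[OF p(2), of "- x0"] by simp
  then have "p x0 = norm x0" using le[of x0] by (simp add: neg)
  moreover have abs_le: "\<bar>p x\<bar> \<le> norm x" for x
    using le[of x] le[of "- x"] by (simp add: neg abs_le_iff)
  moreover have "bounded_linear p"
    by (rule bounded_linear_intro[where K = 1]) (simp_all add: add scale abs_le)
  ultimately show thesis by (intro that)
qed

section \<open>Shifted Poisson kernels\<close>

text \<open>
  The real part is the Poisson kernel, without the factor \<open>1 / \<pi>\<close>, of the half plane \<open>Im z > - e\<close> with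
  pole at \<open>a - i e\<close>. The holomorphic form allows one to exponentiate it; the pole is pushed below the
  real axis so that the kernel is holomorphic on the closed upper half plane.
\<close>

definition poisson_kernel :: "real \<Rightarrow> real \<Rightarrow> complex \<Rightarrow> complex" where
  "poisson_kernel a e z = \<i> / (z - of_real a + \<i> * of_real e)"

lemma Re_poisson_kernel: "Re (poisson_kernel a e z) = (Im z + e) / ((Re z - a)\<^sup>2 + (Im z + e)\<^sup>2)"
  by (simp add: poisson_kernel_def Re_divide power2_eq_square)

lemma Re_poisson_kernel_nonneg: "0 \<le> Im z \<Longrightarrow> 0 < e \<Longrightarrow> 0 \<le> Re (poisson_kernel a e z)"
  by (simp add: Re_poisson_kernel)

lemma holomorphic_on_poisson_kernel:
  assumes "0 < e" and "\<And>z. z \<in> S \<Longrightarrow> 0 \<le> Im z"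
  shows "poisson_kernel a e holomorphic_on S"
proof -
  have "z - of_real a + \<i> * of_real e \<noteq> 0" if "z \<in> S" for z
    using assms(2)[OF that] assms(1) by (auto simp: complex_eq_iff)
  then show ?thesis
    unfolding poisson_kernel_def[abs_def] by (intro holomorphic_intros) auto
qed

lemma Re_poisson_kernel_ge_on_segment:
  assumes "n \<le> t" "t \<le> n + 1"
  shows "1 \<le> 2 * Re (poisson_kernel n 1 (of_real t))"
proof -
  have "(t - n)\<^sup>2 \<le> 1\<^sup>2" using assms by (intro power_mono) auto
  then show ?thesis by (simp add: Re_poisson_kernel field_simps add_pos_nonneg)
qed

lemma Re_poisson_kernel_le_near_0:
  assumes "0 \<le> Im z" "cmod z \<le> 1"
  shows "Re (poisson_kernel a 1 z) \<le> 6 / (1 + a\<^sup>2)"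
proof -
  let ?x = "Re z" let ?y = "Im z"
  have y: "?y \<le> 1" and x: "?x\<^sup>2 \<le> 1"
    using assms(2) abs_Im_le_cmod[of z] abs_Re_le_cmod[of z] by (auto simp: abs_square_le_1)
  have "a\<^sup>2 \<le> 2 * (?x - a)\<^sup>2 + 2 * ?x\<^sup>2"
    using zero_le_power2[of "2 * ?x - a"] by (simp add: power2_eq_square algebra_simps)
  moreover have "1 \<le> (?y + 1)\<^sup>2" using assms(1) by (simp add: one_le_power)
  ultimately have "1 + a\<^sup>2 \<le> 3 * ((?x - a)\<^sup>2 + (?y + 1)\<^sup>2)"
    using x zero_le_power2[of "?x - a"] unfolding distrib_left by (smt (verit))
  moreover have "0 < 1 + a\<^sup>2" by (simp add: add_pos_nonneg)
  ultimately have "(?y + 1) / ((?x - a)\<^sup>2 + (?y + 1)\<^sup>2) \<le> 2 / ((1 + a\<^sup>2) / 3)"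
    using y assms(1) by (intro frac_le) auto
  then show ?thesis by (simp add: Re_poisson_kernel)
qed

text \<open>
  For \<open>\<bar>z\<bar> = R\<close> with nonnegative real part, the triangle inequality \<open>R \<le> Re z + Im z\<close> says that the horizontal
  distance of \<open>z\<close> to the pole at \<open>R - i e\<close> is at most the vertical one, so the kernel with that pole is
  at least \<open>1 / (2 (Im z + e)) \<ge> 1 / (4 R)\<close>. The other kernel serves the left half of the arc.
\<close>

lemma Re_poisson_kernel_sum_ge_on_arc:
  assumes z: "cmod z = R" "0 \<le> Im z" and e: "0 < e" "e \<le> R"
  shows "1 \<le> 4 * R * (Re (poisson_kernel R e z) + Re (poisson_kernel (- R) e z))"
proof -
  have near: "1 \<le> 4 * R * ((y + e) / ((R - x)\<^sup>2 + (y + e)\<^sup>2))"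
    if xy: "0 \<le> x" "0 \<le> y" "x\<^sup>2 + y\<^sup>2 = R\<^sup>2" for x y :: real
  proof -
    have "y\<^sup>2 \<le> R\<^sup>2" "x\<^sup>2 \<le> R\<^sup>2"
      unfolding xy(3)[symmetric] by simp_all
    then have yR: "y \<le> R" and xR: "x \<le> R"
      using e by (auto intro: power2_le_imp_le)
    have "R\<^sup>2 \<le> (x + y)\<^sup>2" using xy(1,2) by (simp add: power2_sum flip: xy(3))
    then have "R \<le> x + y" by (rule power2_le_imp_le) (use xy(1,2) in simp)
    then have "(R - x)\<^sup>2 \<le> (y + e)\<^sup>2" using xR e by (intro power_mono) auto
    moreover have "(y + e)\<^sup>2 \<le> (y + e) * (2 * R)"
      unfolding power2_eq_square using yR e xy(1,2) by (intro mult_left_mono) auto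
    moreover have "4 * R * (y + e) = 2 * ((y + e) * (2 * R))" by simp
    ultimately have "(R - x)\<^sup>2 + (y + e)\<^sup>2 \<le> 4 * R * (y + e)" by linarith
    moreover have "0 < (R - x)\<^sup>2 + (y + e)\<^sup>2" using e xy(1,2) by (simp add: add_nonneg_pos)
    ultimately show ?thesis by (simp add: field_simps)
  qed
  have R: "(Re z)\<^sup>2 + (Im z)\<^sup>2 = R\<^sup>2" using z(1) cmod_power2[of z] by simp
  have nn: "0 \<le> Re (poisson_kernel R e z)" "0 \<le> Re (poisson_kernel (- R) e z)"
    using Re_poisson_kernel_nonneg z(2) e(1) by auto
  show ?thesis
  proof (cases "0 \<le> Re z")
    case True
    have "1 \<le> 4 * R * Re (poisson_kernel R e z)"
      using near[OF True z(2) R] by (simp add: Re_poisson_kernel power2_commute)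
    moreover have "0 \<le> 4 * R * Re (poisson_kernel (- R) e z)" using nn e by simp
    ultimately show ?thesis unfolding distrib_left by linarith
  next
    case False
    have "1 \<le> 4 * R * Re (poisson_kernel (- R) e z)"
      using near[of "- Re z" "Im z"] False z(2) R by (simp add: Re_poisson_kernel add.commute)
    moreover have "0 \<le> 4 * R * Re (poisson_kernel R e z)" using nn e by simp
    ultimately show ?thesis unfolding distrib_left by linarith
  qed
qed

text \<open>
  The decay \<open>e / a\<^sup>2\<close>, with the factor \<open>e\<close>, is what later cancels the type \<open>b\<close> of the function when
  \<open>e = 1 / b\<close>.
\<close>

lemma Re_poisson_kernel_le_far:
  assumes "0 \<le> Im z" "cmod z \<le> e" "0 < e" "e \<le> 1" "2 \<le> \<bar>a\<bar>"
  shows "Re (poisson_kernel a e z) \<le> 8 * e / a\<^sup>2"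
proof -
  have "\<bar>Re z\<bar> \<le> 1" "Im z \<le> e"
    using assms abs_Im_le_cmod[of z] abs_Re_le_cmod[of z] by linarith+
  then have "\<bar>a\<bar> / 2 \<le> \<bar>Re z - a\<bar>" using assms by linarith
  then have "(\<bar>a\<bar> / 2)\<^sup>2 \<le> \<bar>Re z - a\<bar>\<^sup>2" by (intro power_mono) auto
  then have "a\<^sup>2 / 4 \<le> (Re z - a)\<^sup>2 + (Im z + e)\<^sup>2"
    by (intro add_increasing2) (simp_all add: power_divide)
  then have "(Im z + e) / ((Re z - a)\<^sup>2 + (Im z + e)\<^sup>2) \<le> (2 * e) / (a\<^sup>2 / 4)"
    using \<open>Im z \<le> e\<close> assms by (intro frac_le) auto
  then show ?thesis by (simp add: Re_poisson_kernel)
qed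

section \<open>Functions of exponential type near the origin\<close>

lemma half_disc_maximum:
  assumes hol: "F holomorphic_on {z. cmod z \<le> R \<and> 0 \<le> Im z}"
    and arc: "\<And>z. cmod z = R \<Longrightarrow> 0 \<le> Im z \<Longrightarrow> cmod (F z) \<le> B"
    and segment: "\<And>t. \<bar>t\<bar> \<le> R \<Longrightarrow> cmod (F (of_real t)) \<le> B"
    and z: "cmod z \<le> R" "0 \<le> Im z"
  shows "cmod (F z) \<le> B"
proof -
  let ?S = "{z. cmod z \<le> R \<and> 0 \<le> Im z}"
  have "?S = cball 0 R \<inter> {z. 0 \<le> Im z}" by auto
  then have cl: "closed ?S" by (simp add: closed_Int closed_halfspace_Im_ge)
  have bd: "bounded ?S" by (rule bounded_subset[OF bounded_cball[of 0 R]]) auto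
  have "cmod (F u) \<le> B" if u: "u \<in> frontier ?S" for u
  proof -
    have uS: "u \<in> ?S" "u \<notin> interior ?S"
      using u cl by (auto simp: frontier_def)
    have "open (ball 0 R \<inter> {z. 0 < Im z})"
      by (simp add: open_Int open_halfspace_Im_gt)
    moreover have "ball 0 R \<inter> {z. 0 < Im z} \<subseteq> ?S" by auto
    ultimately have "\<not> (cmod u < R \<and> 0 < Im u)"
      using uS(2) interiorI[of "ball 0 R \<inter> {z. 0 < Im z}" u ?S] by auto
    then consider "cmod u = R" | "Im u = 0" using uS(1) by force
    then show ?thesis
    proof cases
      case 1 then show ?thesis using arc uS(1) by simp
    next
      case 2
      then have "u = of_real (Re u)" by (simp add: complex_eq_iff)
      moreover have "\<bar>Re u\<bar> \<le> R" using uS(1) abs_Re_le_cmod[of u] by simp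
      ultimately show ?thesis using segment[of "Re u"] by simp
    qed
  qed
  then show ?thesis
    using maximum_modulus_frontier[of F ?S B z] hol cl bd z
      holomorphic_on_subset[OF hol interior_subset] holomorphic_on_imp_continuous_on[OF hol]
    by simp
qed

text \<open>
  The discrete substitute for the Poisson majorization of functions of exponential type. The point
  is that the conclusion does not depend on \<open>C\<close>. On a half disc of large radius \<open>R\<close> divide \<open>g\<close> by
  \<open>exp \<Phi>\<close>, where \<open>Re \<Phi>\<close> is a nonnegative harmonic function that is at least \<open>w \<lfloor>t\<rfloor>\<close> on the segment
  and at least \<open>b R + ln (C / K)\<close> on the arc. The quotient is then at most \<open>K\<close>, and \<open>Re \<Phi>\<close> is at most
  \<open>12 S + 128\<close> near the origin: the first term comes from the kernels with integer poles, the second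
  from the two kernels that control the arc.
\<close>

lemma exponential_type_half_plane_bound:
  fixes g :: "complex \<Rightarrow> complex" and w :: "int \<Rightarrow> real"
  assumes hol: "g holomorphic_on UNIV"
    and growth: "\<And>z. cmod (g z) \<le> C * exp (b * cmod z)"
    and line: "\<And>t::real. cmod (g (of_real t)) \<le> K * exp (w \<lfloor>t\<rfloor>)"
    and w0: "\<And>n. 0 \<le> w n"
    and w_sum: "\<And>N::nat. (\<Sum>n\<in>{- int N..int N}. w n / (1 + (of_int n)\<^sup>2)) \<le> S"
    and K: "0 < K" and b: "1 \<le> b"
    and z: "0 \<le> Im z" "cmod z \<le> 1 / b"
  shows "cmod (g z) \<le> K * exp (12 * S + 128)"
proof -
  \<comment> \<open>The \<open>1 +\<close> makes \<open>L\<close> nonnegative; \<open>R \<ge> L\<close> then lets \<open>\<Lambda>\<close> be at most \<open>2 b R\<close>.\<close>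
  define L where "L = ln (1 + \<bar>C\<bar> / K)"
  have expL: "exp L = 1 + \<bar>C\<bar> / K" using K by (simp add: L_def add_pos_nonneg)
  have L0: "0 \<le> L" using K by (simp add: L_def)
  obtain N :: nat where N: "max 2 L \<le> real N" using real_arch_simple by blast
  define R where "R = real N"
  have R: "2 \<le> R" "L \<le> R" using N by (auto simp: R_def)
  define \<Lambda> where "\<Lambda> = b * R + L"
  define e where "e = 1 / b"
  have e: "0 < e" "e \<le> 1" using b by (auto simp: e_def)
  have \<Lambda>0: "0 \<le> \<Lambda>" using b R L0 by (simp add: \<Lambda>_def)
  let ?I = "{- int N..int N}"
  define \<Phi> where "\<Phi> u = (\<Sum>n\<in>?I. of_real (2 * w n) * poisson_kernel (of_int n) 1 u)
      + of_real (4 * R * \<Lambda>) * (poisson_kernel R e u + poisson_kernel (- R) e u)" for u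
  have Re\<Phi>: "Re (\<Phi> u) = (\<Sum>n\<in>?I. 2 * w n * Re (poisson_kernel (of_int n) 1 u))
      + \<Lambda> * (4 * R * (Re (poisson_kernel R e u) + Re (poisson_kernel (- R) e u)))" for u
    by (simp add: \<Phi>_def algebra_simps)
  have parts: "0 \<le> 2 * w n * Re (poisson_kernel (of_int n) 1 u)"
      "0 \<le> 4 * R * (Re (poisson_kernel R e u) + Re (poisson_kernel (- R) e u))" if "0 \<le> Im u" for n u
    using that w0 Re_poisson_kernel_nonneg e R by simp_all
  define F where "F u = g u * exp (- \<Phi> u)" for u
  have cmodF: "cmod (F u) = cmod (g u) * exp (- Re (\<Phi> u))" for u
    by (simp add: F_def norm_mult)
  have "cmod (F z) \<le> K"
  proof (rule half_disc_maximum[where F = F and R = R and B = K])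
    show "F holomorphic_on {z. cmod z \<le> R \<and> 0 \<le> Im z}"
    proof -
      have "g holomorphic_on {z. cmod z \<le> R \<and> 0 \<le> Im z}"
        using hol by (rule holomorphic_on_subset) simp
      moreover have "\<Phi> holomorphic_on {z. cmod z \<le> R \<and> 0 \<le> Im z}"
        unfolding \<Phi>_def[abs_def] using e
        by (intro holomorphic_on_add holomorphic_on_mult holomorphic_on_sum
            holomorphic_on_const holomorphic_on_poisson_kernel) auto
      ultimately show ?thesis
        unfolding F_def[abs_def]
        by (intro holomorphic_on_mult holomorphic_on_exp' holomorphic_on_minus)
    qed
  next
    fix u assume u: "cmod u = R" "0 \<le> Im u"
    have "\<Lambda> * 1 \<le> \<Lambda> * (4 * R * (Re (poisson_kernel R e u) + Re (poisson_kernel (- R) e u)))"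
      using Re_poisson_kernel_sum_ge_on_arc[OF u] e R \<Lambda>0 by (intro mult_left_mono) auto
    moreover have "0 \<le> (\<Sum>n\<in>?I. 2 * w n * Re (poisson_kernel (of_int n) 1 u))"
      using parts(1)[OF u(2)] by (intro sum_nonneg) auto
    ultimately have "\<Lambda> \<le> Re (\<Phi> u)" unfolding Re\<Phi> by simp
    then have "cmod (F u) \<le> (C * exp (b * R)) * exp (- \<Lambda>)"
      unfolding cmodF using growth[of u] u order_trans[OF norm_ge_zero growth[of u]]
      by (intro mult_mono) auto
    also have "\<dots> = C * exp (- L)" by (simp add: \<Lambda>_def flip: exp_add)
    also have "\<dots> \<le> K"
    proof -
      have "C \<le> K * exp L" using K by (simp add: expL distrib_left)
      then have "C * exp (- L) \<le> K * exp L * exp (- L)" by (rule mult_right_mono) simp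
      then show ?thesis by (simp add: mult.assoc flip: exp_add)
    qed
    finally show "cmod (F u) \<le> K" .
  next
    fix t :: real assume t: "\<bar>t\<bar> \<le> R"
    then have "- real N \<le> t" "t \<le> real N" by (auto simp: R_def abs_le_iff)
    then have mem: "\<lfloor>t\<rfloor> \<in> ?I"
      using floor_mono[of t "real N"] by (simp add: le_floor_iff)
    have "1 \<le> 2 * Re (poisson_kernel (of_int \<lfloor>t\<rfloor>) 1 (of_real t))"
      by (intro Re_poisson_kernel_ge_on_segment of_int_floor_le real_of_int_floor_add_one_ge)
    then have "w \<lfloor>t\<rfloor> * 1 \<le> w \<lfloor>t\<rfloor> * (2 * Re (poisson_kernel (of_int \<lfloor>t\<rfloor>) 1 (of_real t)))"
      using w0 by (rule mult_left_mono)
    also have "\<dots> = 2 * w \<lfloor>t\<rfloor> * Re (poisson_kernel (of_int \<lfloor>t\<rfloor>) 1 (of_real t))" by simp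
    also have "\<dots> \<le> (\<Sum>n\<in>?I. 2 * w n * Re (poisson_kernel (of_int n) 1 (of_real t)))"
      using parts(1)[of "of_real t"] mem by (intro member_le_sum) auto
    also have "\<dots> \<le> Re (\<Phi> (of_real t))"
      unfolding Re\<Phi> using parts(2)[of "of_real t"] \<Lambda>0 by simp
    finally have "w \<lfloor>t\<rfloor> \<le> Re (\<Phi> (of_real t))" by simp
    then have "cmod (F (of_real t)) \<le> (K * exp (w \<lfloor>t\<rfloor>)) * exp (- w \<lfloor>t\<rfloor>)"
      unfolding cmodF using line[of t] K by (intro mult_mono) auto
    then show "cmod (F (of_real t)) \<le> K"
      by (simp add: mult.assoc flip: exp_add)
  next
    show "cmod z \<le> R" using z(2) e R unfolding e_def by linarith
  qed (fact z(1))
  moreover have "Re (\<Phi> z) \<le> 12 * S + 128"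
  proof -
    have ze: "cmod z \<le> e" "cmod z \<le> 1" using z(2) e unfolding e_def by linarith+
    have "(\<Sum>n\<in>?I. 2 * w n * Re (poisson_kernel (of_int n) 1 z))
        \<le> (\<Sum>n\<in>?I. 2 * w n * (6 / (1 + (of_int n)\<^sup>2)))"
      using Re_poisson_kernel_le_near_0[OF z(1) ze(2)] w0 by (intro sum_mono mult_left_mono) auto
    also have "\<dots> = 12 * (\<Sum>n\<in>?I. w n / (1 + (of_int n)\<^sup>2))"
      unfolding sum_distrib_left by (intro sum.cong) auto
    also have "\<dots> \<le> 12 * S" using w_sum[of N] by simp
    finally have 1: "(\<Sum>n\<in>?I. 2 * w n * Re (poisson_kernel (of_int n) 1 z)) \<le> 12 * S" .
    have far: "Re (poisson_kernel R e z) + Re (poisson_kernel (- R) e z) \<le> 16 * e / R\<^sup>2"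
      using Re_poisson_kernel_le_far[OF z(1) ze(1) e, of R] Re_poisson_kernel_le_far[OF z(1) ze(1) e, of "- R"] R
      by (simp add: add_divide_distrib[symmetric])
    have \<Lambda>_le: "\<Lambda> \<le> 2 * b * R"
    proof -
      have "R \<le> b * R" using b R by simp
      then show ?thesis using R unfolding \<Lambda>_def by linarith
    qed
    have "\<Lambda> * (4 * R * (Re (poisson_kernel R e z) + Re (poisson_kernel (- R) e z)))
        \<le> (2 * b * R) * (4 * R * (16 * e / R\<^sup>2))"
      by (rule mult_mono[OF \<Lambda>_le mult_left_mono[OF far]]) (use b R parts(2)[OF z(1)] in simp_all)
    also have "\<dots> = 128"
    proof -
      have "b \<noteq> 0" "R \<noteq> 0" using b R by auto
      then show ?thesis by (simp add: e_def power2_eq_square)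
    qed
    finally show ?thesis unfolding Re\<Phi> using 1 by linarith
  qed
  ultimately have "cmod (F z) * exp (Re (\<Phi> z)) \<le> K * exp (12 * S + 128)"
    using K by (intro mult_mono) auto
  then show ?thesis by (simp add: cmodF mult.assoc flip: exp_add)
qed

text \<open>
  The lower half plane is treated by \<open>z \<mapsto> cnj (g (cnj z))\<close>. Unlike \<open>z \<mapsto> g (- z)\<close> this reflection keeps
  the modulus of \<open>g\<close> at each real point, so the same majorant \<open>w\<close> serves both halves.
\<close>

lemma exponential_type_disc_bound:
  fixes g :: "complex \<Rightarrow> complex" and w :: "int \<Rightarrow> real"
  assumes hol: "g holomorphic_on UNIV"
    and growth: "\<And>z. cmod (g z) \<le> C * exp (b * cmod z)"
    and line: "\<And>t::real. cmod (g (of_real t)) \<le> K * exp (w \<lfloor>t\<rfloor>)"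
    and w0: "\<And>n. 0 \<le> w n"
    and w_sum: "\<And>N::nat. (\<Sum>n\<in>{- int N..int N}. w n / (1 + (of_int n)\<^sup>2)) \<le> S"
    and K: "0 < K" and b: "1 \<le> b"
    and z: "cmod z \<le> 1 / b"
  shows "cmod (g z) \<le> K * exp (12 * S + 128)"
proof (cases "0 \<le> Im z")
  case True
  then show ?thesis
    using exponential_type_half_plane_bound[OF hol growth line w0 w_sum K b _ z] by simp
next
  case False
  let ?h = "cnj \<circ> g \<circ> cnj"
  have "?h holomorphic_on UNIV"
    using hol by (intro holomorphic_on_compose_cnj_cnj) (auto simp: image_cnj_conv_vimage_cnj)
  moreover have "cmod (?h u) \<le> C * exp (b * cmod u)" for u
    using growth[of "cnj u"] by simp
  moreover have "cmod (?h (of_real t)) \<le> K * exp (w \<lfloor>t\<rfloor>)" for t :: real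
    using line[of t] by simp
  ultimately have "cmod (?h (cnj z)) \<le> K * exp (12 * S + 128)"
    by (rule exponential_type_half_plane_bound[OF _ _ _ w0 w_sum K b]) (use False z in auto)
  then show ?thesis by simp
qed

section \<open>Step function majorants of subadditive functions\<close>

text \<open>
  The correction \<open>4 / (N + 1)\<close> makes the induction go through: from \<open>N\<close> to \<open>N + 1\<close> it drops by
  \<open>4 / ((N + 1) (N + 2))\<close>, which is at least the sum of the two new terms.
\<close>

lemma sum_inverse_one_plus_square_le:
  "(\<Sum>n\<in>{- int N..int N}. 1 / (1 + (of_int n)\<^sup>2)) \<le> 5 - 4 / (real N + 1)"
proof (induction N)
  case 0
  then show ?case by simp
next
  case (Suc N)
  have "{- int (Suc N)..int (Suc N)} = insert (int (Suc N)) (insert (- int (Suc N)) {- int N..int N})"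
    by auto
  moreover have "(- 1 - real N)\<^sup>2 = (real N + 1)\<^sup>2"
    by (simp add: power2_eq_square algebra_simps)
  ultimately have "(\<Sum>n\<in>{- int (Suc N)..int (Suc N)}. 1 / (1 + (of_int n)\<^sup>2))
      = 2 / (1 + (real N + 1)\<^sup>2) + (\<Sum>n\<in>{- int N..int N}. 1 / (1 + (of_int n)\<^sup>2) :: real)"
    by (simp add: add.commute)
  also have "2 / (1 + (real N + 1)\<^sup>2) \<le> 4 / (real N + 1) - 4 / (real N + 2)"
  proof -
    have "4 / (real N + 1) - 4 / (real N + 2) = 4 / ((real N + 1) * (real N + 2))"
      by (simp add: field_simps)
    moreover have "2 / (1 + (real N + 1)\<^sup>2) \<le> 4 / ((real N + 1) * (real N + 2))"
    proof -
      have "(real N + 1) * (real N + 2) \<le> 2 * (1 + (real N + 1)\<^sup>2)"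
        by (simp add: power2_eq_square algebra_simps)
      moreover have "0 < 1 + (real N + 1)\<^sup>2" by (simp add: add_pos_nonneg)
      ultimately show ?thesis by (simp add: divide_le_eq pos_le_divide_eq mult.commute)
    qed
    ultimately show ?thesis by simp
  qed
  finally show ?case using Suc by (simp add: add.commute)
qed

lemma sum_indicator_unit_neighbourhood_le:
  "(\<Sum>n\<in>{- int N..int N}. indicator {of_int n - 1..of_int n + 1} t) \<le> (3 :: real)" for t :: real
proof -
  let ?J = "{n \<in> {- int N..int N}. t \<in> {of_int n - 1..of_int n + 1}}"
  have "(\<Sum>n\<in>{- int N..int N}. indicator {of_int n - 1..of_int n + 1} t) = real (card ?J)"
    by (simp add: indicator_def sum.If_cases Int_def)
  also have "card ?J \<le> card {\<lfloor>t\<rfloor> - 1..\<lfloor>t\<rfloor> + 1}"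
    by (rule card_mono) (auto; linarith)+
  then have "real (card ?J) \<le> 3" by simp
  finally show ?thesis .
qed

text \<open>
  Subadditivity upgrades an integral condition to a pointwise one, and in particular makes \<open>f\<close>
  locally bounded above. For \<open>t \<in> [n, n + 1)\<close> and \<open>s \<in> [0, 1]\<close> one has \<open>f t \<le> \<bar>f (t - s)\<bar> + \<bar>f s\<bar>\<close> with
  \<open>t - s \<in> [n - 1, n + 1]\<close>; integrating over \<open>s\<close> bounds \<open>f t\<close> by integrals of \<open>\<bar>f\<bar>\<close> over \<open>[n - 1, n + 1]\<close>
  and \<open>[0, 1]\<close>. On the former interval the weight \<open>1 + s\<^sup>2\<close> is comparable to \<open>1 + n\<^sup>2\<close>, and each point lies
  in at most three such intervals, so the weighted sum is controlled by the integral of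
  \<open>\<bar>f s\<bar> / (1 + s\<^sup>2)\<close>.
\<close>

lemma subadditive_majorant:
  fixes f :: "real \<Rightarrow> real"
  assumes sub: "\<And>s t. f (s + t) \<le> f s + f t"
    and int: "integrable lebesgue (\<lambda>t. f t / (1 + t\<^sup>2))"
  obtains w :: "int \<Rightarrow> real" and S
  where "\<And>n. 0 \<le> w n" "\<And>t. f t \<le> w \<lfloor>t\<rfloor>"
    "\<And>N::nat. (\<Sum>n\<in>{- int N..int N}. w n / (1 + (of_int n)\<^sup>2)) \<le> S"
proof -
  define \<rho> where "\<rho> s = \<bar>f s\<bar> / (1 + s\<^sup>2)" for s
  have pos: "0 < 1 + s\<^sup>2" for s :: real by (simp add: add_pos_nonneg)
  have \<rho>0: "0 \<le> \<rho> s" for s by (simp add: \<rho>_def)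
  have f\<rho>: "\<bar>f s\<bar> = (1 + s\<^sup>2) * \<rho> s" for s using pos[of s] by (simp add: \<rho>_def)
  have \<rho>_int: "integrable lebesgue \<rho>"
    using integrable_abs[OF int] by (simp add: \<rho>_def[abs_def] abs_divide)
  define I where "I = (\<integral>s. \<rho> s \<partial>lebesgue)"
  have I0: "0 \<le> I" by (simp add: I_def \<rho>0)
  define h where "h n s = indicator {of_int n - 1..of_int n + 1} s * \<rho> s" for n :: int and s
  have h0: "0 \<le> h n s" for n s by (simp add: h_def \<rho>0)
  have h_int: "integrable lebesgue (h n)" for n
    using integrable_mult_indicator[OF _ \<rho>_int, of "{of_int n - 1..of_int n + 1}"]
    by (simp add: h_def[abs_def])
  define r where "r n = (\<integral>s. h n s \<partial>lebesgue)" for n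
  have r0: "0 \<le> r n" for n by (simp add: r_def h0)
  define w where "w n = 3 * (1 + (of_int n)\<^sup>2) * r n + 2 * I" for n
  show thesis
  proof
    show "0 \<le> w n" for n
      unfolding w_def using r0[of n] I0 pos[of "of_int n"] by simp
  next
    fix t :: real
    let ?n = "\<lfloor>t\<rfloor>"
    have pw: "indicator {0..1} s * f t
        \<le> 3 * (1 + (of_int ?n)\<^sup>2) * h ?n (t + (- 1) * s) + 2 * \<rho> s" for s :: real
    proof (cases "s \<in> {0..1}")
      case True
      have near: "\<bar>t - s - of_int ?n\<bar> \<le> 1" using True by (simp; linarith)
      have "f t \<le> \<bar>f (t - s)\<bar> + \<bar>f s\<bar>" using sub[of "t - s" s] by simp
      also have "\<bar>f s\<bar> \<le> 2 * \<rho> s"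
      proof -
        have "s\<^sup>2 \<le> 1" using True by (simp add: power_le_one)
        then show ?thesis unfolding f\<rho> using \<rho>0[of s] by (intro mult_right_mono) auto
      qed
      also have "\<bar>f (t - s)\<bar> \<le> 3 * (1 + (of_int ?n)\<^sup>2) * \<rho> (t - s)"
      proof -
        have "(t - s - of_int ?n)\<^sup>2 \<le> 1" using near by (simp add: abs_square_le_1)
        moreover have "(t - s)\<^sup>2 \<le> 2 * (t - s - of_int ?n)\<^sup>2 + 2 * (of_int ?n)\<^sup>2"
          using zero_le_power2[of "t - s - 2 * of_int ?n"]
          by (simp add: power2_eq_square algebra_simps)
        ultimately have "1 + (t - s)\<^sup>2 \<le> 3 * (1 + (of_int ?n)\<^sup>2)"
          using zero_le_power2[of "of_int ?n :: real"] unfolding distrib_left by linarith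
        then show ?thesis unfolding f\<rho> using \<rho>0 by (rule mult_right_mono)
      qed
      also have "\<rho> (t - s) = h ?n (t + (- 1) * s)"
        using near by (simp add: h_def abs_le_iff)
      finally show ?thesis using True by simp
    next
      case False
      then show ?thesis using h0 \<rho>0 pos by simp
    qed
    have refl_int: "integrable lebesgue (\<lambda>s. h ?n (t + (- 1) * s))"
      using h_int by (subst lebesgue_integrable_real_affine_iff) auto
    have "f t = (\<integral>s. indicator {0..1} s * f t \<partial>(lebesgue :: real measure))" by simp
    also have "\<dots> \<le> (\<integral>s. 3 * (1 + (of_int ?n)\<^sup>2) * h ?n (t + (- 1) * s) + 2 * \<rho> s \<partial>lebesgue)"
    proof (rule integral_mono)
      show "integrable lebesgue (\<lambda>s::real. indicator {0..1} s * f t)"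
        by (intro integrable_mult_left integrable_real_indicator) auto
      show "integrable lebesgue (\<lambda>s. 3 * (1 + (of_int ?n)\<^sup>2) * h ?n (t + (- 1) * s) + 2 * \<rho> s)"
        using refl_int \<rho>_int by (intro Bochner_Integration.integrable_add integrable_mult_right) auto
    qed (use pw in simp)
    also have "\<dots> = 3 * (1 + (of_int ?n)\<^sup>2) * (\<integral>s. h ?n (t + (- 1) * s) \<partial>lebesgue) + 2 * I"
      using refl_int \<rho>_int by (simp add: I_def)
    also have "(\<integral>s. h ?n (t + (- 1) * s) \<partial>lebesgue) = r ?n"
      unfolding r_def using lebesgue_integral_real_affine[of "- 1" "h ?n" t] by simp
    finally show "f t \<le> w ?n" by (simp add: w_def)
  next
    fix N :: nat
    let ?I = "{- int N..int N}"
    have "(\<Sum>n\<in>?I. r n) = (\<integral>s. (\<Sum>n\<in>?I. h n s) \<partial>lebesgue)"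
      unfolding r_def using h_int by simp
    also have "\<dots> \<le> (\<integral>s. 3 * \<rho> s \<partial>lebesgue)"
    proof (rule integral_mono)
      show "(\<Sum>n\<in>?I. h n s) \<le> 3 * \<rho> s" for s
        unfolding h_def sum_distrib_right[symmetric]
        using sum_indicator_unit_neighbourhood_le \<rho>0 by (rule mult_right_mono)
    qed (use h_int \<rho>_int in auto)
    also have "\<dots> = 3 * I" by (simp add: I_def)
    finally have r_sum: "(\<Sum>n\<in>?I. r n) \<le> 3 * I" .
    have "w n / (1 + (of_int n)\<^sup>2) = 3 * r n + 2 * I * (1 / (1 + (of_int n)\<^sup>2))" for n
    proof -
      have "1 + (of_int n)\<^sup>2 \<noteq> (0 :: real)" using pos[of "of_int n"] by simp
      then show ?thesis by (simp only: w_def) (simp add: divide_simps)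
    qed
    then have "(\<Sum>n\<in>?I. w n / (1 + (of_int n)\<^sup>2))
        = 3 * (\<Sum>n\<in>?I. r n) + 2 * I * (\<Sum>n\<in>?I. 1 / (1 + (of_int n)\<^sup>2))"
      by (simp add: sum.distrib sum_distrib_left)
    also have "\<dots> \<le> 3 * (3 * I) + 2 * I * 5"
    proof -
      have "(\<Sum>n\<in>?I. 1 / (1 + (of_int n)\<^sup>2)) \<le> (5 :: real)"
        using sum_inverse_one_plus_square_le[of N] by (smt (verit) divide_nonneg_nonneg of_nat_0_le_iff)
      then show ?thesis using r_sum I0 by (intro add_mono mult_left_mono) auto
    qed
    also have "\<dots> = 19 * I" by simp
    finally show "(\<Sum>n\<in>?I. w n / (1 + (of_int n)\<^sup>2)) \<le> 19 * I" .
  qed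
qed

section \<open>Entire functions given by exponential series\<close>

lemma summable_exponential_bounded_coeffs:
  fixes b :: "nat \<Rightarrow> complex"
  assumes b: "\<And>k. cmod (b k) \<le> c * \<beta> ^ k"
  shows "summable (\<lambda>k. norm (b k / fact k * z ^ k))"
    and "cmod (\<Sum>k. b k / fact k * z ^ k) \<le> c * exp (\<beta> * cmod z)"
proof -
  have sums: "(\<lambda>k. c * ((\<beta> * cmod z) ^ k /\<^sub>R fact k)) sums (c * exp (\<beta> * cmod z))"
    by (intro sums_mult exp_converges)
  have le: "norm (b k / fact k * z ^ k) \<le> c * ((\<beta> * cmod z) ^ k /\<^sub>R fact k)" for k
  proof -
    have "norm (b k / fact k * z ^ k) = cmod (b k) * (cmod z ^ k / fact k)"
      by (simp add: norm_mult norm_divide norm_power)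
    also have "\<dots> \<le> (c * \<beta> ^ k) * (cmod z ^ k / fact k)"
      using b by (rule mult_right_mono) simp
    finally show ?thesis by (simp add: power_mult_distrib field_simps)
  qed
  show summ: "summable (\<lambda>k. norm (b k / fact k * z ^ k))"
    using le by (intro summable_comparison_test[OF _ sums_summable[OF sums]]) auto
  have "cmod (\<Sum>k. b k / fact k * z ^ k) \<le> (\<Sum>k. norm (b k / fact k * z ^ k))"
    by (rule summable_norm[OF summ])
  also have "\<dots> \<le> (\<Sum>k. c * ((\<beta> * cmod z) ^ k /\<^sub>R fact k))"
    using le summ sums_summable[OF sums] by (rule suminf_le)
  also have "\<dots> = c * exp (\<beta> * cmod z)" using sums by (rule sums_unique[symmetric])
  finally show "cmod (\<Sum>k. b k / fact k * z ^ k) \<le> c * exp (\<beta> * cmod z)" .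
qed

lemma higher_deriv_exponential_series:
  fixes b :: "nat \<Rightarrow> complex"
  assumes b: "\<And>k. cmod (b k) \<le> c * \<beta> ^ k"
  defines "g \<equiv> \<lambda>z. \<Sum>k. b k / fact k * z ^ k"
  shows "g holomorphic_on UNIV" and "(deriv ^^ n) g 0 = b n"
proof -
  \<comment> \<open>Differentiation shifts the coefficient sequence of an exponential series.\<close>
  define G where "G m z = (\<Sum>k. b (k + m) / fact k * z ^ k)" for m z
  have DG: "(G m has_field_derivative G (Suc m) z) (at z)" for m z
  proof -
    have "cmod (b (k + m)) \<le> (c * \<beta> ^ m) * \<beta> ^ k" for k
      using b[of "k + m"] by (simp add: power_add mult_ac)
    then have "summable (\<lambda>k. b (k + m) / fact k * u ^ k)" for u
      by (rule summable_norm_cancel[OF summable_exponential_bounded_coeffs(1)])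
    then have "(G m has_field_derivative (\<Sum>k. diffs (\<lambda>k. b (k + m) / fact k) k * z ^ k)) (at z)"
      unfolding G_def[abs_def] by (rule termdiffs_strong_converges_everywhere)
    moreover have "diffs (\<lambda>k. b (k + m) / fact k) k = b (k + Suc m) / fact k" for k
      by (simp add: diffs_def field_simps del: of_nat_Suc)
    ultimately show ?thesis by (simp add: G_def)
  qed
  have g: "g = G 0" by (simp add: g_def G_def[abs_def])
  show "g holomorphic_on UNIV"
    unfolding g holomorphic_on_def field_differentiable_def using DG by auto
  have "(deriv ^^ n) (G 0) = G n" for n
    by (induction n) (use DG in \<open>auto intro!: DERIV_imp_deriv\<close>)
  then show "(deriv ^^ n) g 0 = b n"
    using powser_zero[of "\<lambda>k. b (k + n) / fact k"] by (simp add: g G_def)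
qed

section \<open>Strongly continuous groups and their orbits\<close>

lemma C0_group_bounded_linear: "C0_group U \<Longrightarrow> bounded_linear (U t)"
  by (simp add: C0_group_def bounded_clinear_def)

lemma C0_group_scaleC: "C0_group U \<Longrightarrow> U t (c *\<^sub>C x) = c *\<^sub>C U t x"
  by (simp add: C0_group_def bounded_clinear_def)

lemma C0_group_0: "C0_group U \<Longrightarrow> U 0 x = x"
  by (simp add: C0_group_def)

lemma C0_group_add: "C0_group U \<Longrightarrow> U (s + t) x = U s (U t x)"
  by (simp add: C0_group_def)

text \<open>
  Positivity of the operator norms is needed to pass from products to sums with \<open>ln\<close>, whose value at \<open>0\<close>
  is the default \<open>0\<close>; it fails only on the null space, where the operator norm of every map vanishes.
\<close>

lemma C0_group_onorm_pos:
  fixes U :: "real \<Rightarrow> 'a::complex_banach \<Rightarrow> 'a" and x :: 'a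
  assumes U: "C0_group U" and x: "x \<noteq> 0"
  shows "0 < onorm (U t)"
proof (rule ccontr)
  assume "\<not> 0 < onorm (U t)"
  then have "U t x = 0"
    using onorm_pos_lt[OF C0_group_bounded_linear[OF U, of t]] by blast
  moreover have "x = U (- t) (U t x)"
    using C0_group_add[OF U, of "- t" t x] C0_group_0[OF U] by simp
  moreover have "U (- t) 0 = 0"
    using C0_group_bounded_linear[OF U] by (rule linear_simps)
  ultimately show False using x by simp
qed

lemma ln_onorm_C0_group_subadditive:
  fixes U :: "real \<Rightarrow> 'a::complex_banach \<Rightarrow> 'a" and x :: 'a
  assumes U: "C0_group U" and x: "x \<noteq> 0"
  shows "ln (onorm (U (s + t))) \<le> ln (onorm (U s)) + ln (onorm (U t))"
proof -
  note pos = C0_group_onorm_pos[OF U x]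
  have "U (s + t) = U s \<circ> U t" using U by (simp add: C0_group_def)
  then have "onorm (U (s + t)) \<le> onorm (U s) * onorm (U t)"
    using onorm_compose C0_group_bounded_linear[OF U] by metis
  then have "ln (onorm (U (s + t))) \<le> ln (onorm (U s) * onorm (U t))"
    using pos by (simp add: ln_mono)
  then show ?thesis using pos[of s] pos[of t] by (simp add: ln_mult)
qed

lemma orbit_DERIV:
  fixes \<psi> :: "'a::complex_banach \<Rightarrow> real"
  assumes U: "C0_group U" and gen: "is_generator U D B" and x: "x \<in> D"
    and psi: "bounded_linear \<psi>"
  shows "((\<lambda>t. \<psi> (U t x)) has_real_derivative \<psi> (U t (B x))) (at t)"
proof -
  have comp: "bounded_linear (\<lambda>y. \<psi> (U t y))"
    using bounded_linear_compose[OF psi C0_group_bounded_linear[OF U]] .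
  interpret bounded_linear "\<lambda>y. \<psi> (U t y)" by fact
  have "((\<lambda>h. (U h x - x) /\<^sub>R h) \<longlongrightarrow> B x) (at 0)"
    using gen x by (simp add: is_generator_def)
  then have "((\<lambda>h. \<psi> (U t ((U h x - x) /\<^sub>R h))) \<longlongrightarrow> \<psi> (U t (B x))) (at 0)"
    by (rule tendsto)
  moreover have "\<psi> (U t ((U h x - x) /\<^sub>R h)) = (\<psi> (U (t + h) x) - \<psi> (U t x)) / h" for h
    by (simp add: scale diff C0_group_add[OF U] divide_inverse mult.commute)
  ultimately show ?thesis by (simp add: DERIV_def)
qed

text \<open>
  The Taylor expansion of the orbit of an entire vector. The \<open>n\<close>-th derivative of the real function
  \<open>s \<mapsto> \<psi> (U s x)\<close> is \<open>\<psi> (U s ((i A)\<^sup>n x))\<close>; since the group is bounded on \<open>[- \<bar>t\<bar>, \<bar>t\<bar>]\<close>, the Lagrange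
  remainder is of order \<open>(\<beta> \<bar>t\<bar>)\<^sup>n / n!\<close>.
\<close>

lemma orbit_exponential_series:
  fixes \<psi> :: "'a::complex_banach \<Rightarrow> real"
  assumes U: "C0_group U" and gen: "is_generator U D (\<lambda>x. \<i> *\<^sub>C A x)"
    and x: "x \<in> C_infinity D A" and growth: "\<And>k. norm ((A ^^ k) x) \<le> c * \<beta> ^ k"
    and bounded: "\<And>s. \<bar>s\<bar> \<le> \<bar>t\<bar> \<Longrightarrow> onorm (U s) \<le> M"
    and psi: "bounded_linear \<psi>"
  shows "(\<lambda>k. \<psi> (\<i> ^ k *\<^sub>C (A ^^ k) x) / fact k * t ^ k) sums \<psi> (U t x)"
proof -
  define a where "a k = \<i> ^ k *\<^sub>C (A ^^ k) x" for k
  have norm_a: "norm (a k) \<le> c * \<beta> ^ k" for k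
    using growth by (simp add: a_def norm_scaleC norm_power)
  have dom: "(A ^^ k) x \<in> D" for k
    using x by (auto simp: C_infinity_def dest!: spec[of _ "Suc k"])
  have deriv: "((\<lambda>s. \<psi> (U s (a k))) has_real_derivative \<psi> (U s (a (Suc k)))) (at s)" for k s
  proof -
    have scaled: "bounded_linear (\<lambda>y. \<psi> (\<i> ^ k *\<^sub>C y))"
    proof (rule bounded_linear_compose[OF psi])
      show "bounded_linear (\<lambda>y::'a. \<i> ^ k *\<^sub>C y)"
        by (rule bounded_linear_intro[where K = 1])
          (simp_all add: scaleC_add_right scaleR_scaleC scaleC_scaleC mult.commute
            norm_scaleC norm_power)
    qed
    have "((\<lambda>s. \<psi> (\<i> ^ k *\<^sub>C U s ((A ^^ k) x)))
        has_real_derivative \<psi> (\<i> ^ k *\<^sub>C U s (\<i> *\<^sub>C A ((A ^^ k) x)))) (at s)"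
      by (rule orbit_DERIV[OF U gen dom scaled])
    then show ?thesis
      by (simp add: a_def C0_group_scaleC[OF U] scaleC_scaleC mult.commute)
  qed
  obtain K where K: "0 < K" "\<And>y. \<bar>\<psi> y\<bar> \<le> norm y * K"
    using bounded_linear.pos_bounded[OF psi] by auto
  have M0: "0 \<le> M"
    using onorm_pos_le[OF C0_group_bounded_linear[OF U, of t]] bounded[of t] by simp
  have "norm ((\<Sum>k<n. \<psi> (a k) / fact k * t ^ k) - \<psi> (U t x))
      \<le> (K * M * c) * ((\<beta> * \<bar>t\<bar>) ^ n /\<^sub>R fact n)" for n
  proof -
    obtain s where s: "\<bar>s\<bar> \<le> \<bar>t\<bar>" and eq: "\<psi> (U t (a 0))
        = (\<Sum>k<n. \<psi> (U 0 (a k)) / fact k * t ^ k) + \<psi> (U s (a n)) / fact n * t ^ n"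
      using Maclaurin_all_le[of "\<lambda>k s. \<psi> (U s (a k))" "\<lambda>s. \<psi> (U s (a 0))" t n] deriv by auto
    have a0: "a 0 = x" using scaleR_scaleC[of 1 x] by (simp add: a_def)
    have "\<bar>\<psi> (U s (a n))\<bar> \<le> norm (U s (a n)) * K" by (rule K(2))
    also have "\<dots> \<le> (M * (c * \<beta> ^ n)) * K"
    proof (rule mult_right_mono)
      have "norm (U s (a n)) \<le> onorm (U s) * norm (a n)"
        by (rule onorm[OF C0_group_bounded_linear[OF U]])
      also have "\<dots> \<le> M * (c * \<beta> ^ n)"
        using bounded[OF s] norm_a[of n] M0 by (intro mult_mono) auto
      finally show "norm (U s (a n)) \<le> M * (c * \<beta> ^ n)" .
    qed (use K in simp)
    finally have rem: "\<bar>\<psi> (U s (a n))\<bar> \<le> (M * (c * \<beta> ^ n)) * K" .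
    have "norm ((\<Sum>k<n. \<psi> (a k) / fact k * t ^ k) - \<psi> (U t x))
        = \<bar>\<psi> (U s (a n))\<bar> * (\<bar>t\<bar> ^ n / fact n)"
      using eq by (simp add: a0 C0_group_0[OF U] abs_mult power_abs)
    also have "\<dots> \<le> ((M * (c * \<beta> ^ n)) * K) * (\<bar>t\<bar> ^ n / fact n)"
      using rem by (rule mult_right_mono) simp
    finally show ?thesis by (simp add: power_mult_distrib divide_inverse mult_ac)
  qed
  then have "\<forall>\<^sub>F n in sequentially. norm ((\<Sum>k<n. \<psi> (a k) / fact k * t ^ k) - \<psi> (U t x))
      \<le> (K * M * c) * ((\<beta> * \<bar>t\<bar>) ^ n /\<^sub>R fact n)"
    by (intro always_eventually allI)
  moreover have "(\<lambda>n. (K * M * c) * ((\<beta> * \<bar>t\<bar>) ^ n /\<^sub>R fact n)) \<longlonglongrightarrow> (K * M * c) * 0"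
    by (rule tendsto_mult_left[OF summable_LIMSEQ_zero[OF summable_exp_generic]])
  ultimately have "(\<lambda>n. (\<Sum>k<n. \<psi> (a k) / fact k * t ^ k) - \<psi> (U t x)) \<longlonglongrightarrow> 0"
    unfolding mult_zero_right by (rule Lim_null_comparison)
  then show ?thesis
    unfolding sums_def a_def[symmetric] by (rule LIM_zero_cancel)
qed

text \<open>
  The type is an infimum that need not be attained, so the growth estimate is only available
  strictly above it.
\<close>

lemma exp_type_less_growth:
  assumes x: "x \<in> exp_type_vectors D A" and type: "exp_type D A x < \<beta>"
  obtains c where "x \<in> C_infinity D A" "0 < c" "\<And>k. norm ((A ^^ k) x) \<le> c * \<beta> ^ k"
proof -
  let ?S = "{\<alpha>. 0 < \<alpha> \<and> x \<in> exp_type_vectors_le D A \<alpha>}"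
  have "?S \<noteq> {}" using x by (auto simp: exp_type_vectors_def)
  moreover have "Inf ?S < \<beta>" using type by (simp add: exp_type_def)
  ultimately obtain \<alpha> where "\<alpha> \<in> ?S" "\<alpha> < \<beta>"
    using cInf_lessD[of ?S \<beta>] by blast
  then have "0 < \<alpha>" "x \<in> exp_type_vectors_le D A \<alpha>" by simp_all
  then obtain c where c: "x \<in> C_infinity D A" "0 < c" "\<And>k. norm ((A ^^ k) x) \<le> c * \<alpha> ^ k"
    unfolding exp_type_vectors_le_def by blast
  have "norm ((A ^^ k) x) \<le> c * \<beta> ^ k" for k
  proof -
    have "c * \<alpha> ^ k \<le> c * \<beta> ^ k"
      using c(2) \<open>0 < \<alpha>\<close> \<open>\<alpha> < \<beta>\<close> by (intro mult_left_mono power_mono) auto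
    then show ?thesis using c(3)[of k] by simp
  qed
  then show thesis using c that by blast
qed

section \<open>Norm estimates for powers of the generator\<close>

text \<open>
  A real norming functional suffices: the coefficients \<open>\<psi> ((i A)\<^sup>k x)\<close> are real, and the resulting
  power series extends \<open>t \<mapsto> \<psi> (U t x)\<close> to an entire function.
  Only its values on the real line have to be identified with those of the orbit; the estimate on
  the disc then comes from the theory of functions of exponential type.
\<close>

lemma norm_funpow_le:
  fixes U :: "real \<Rightarrow> 'a::complex_banach \<Rightarrow> 'a" and w :: "int \<Rightarrow> real"
  assumes U: "C0_group U" and gen: "is_generator U D (\<lambda>x. \<i> *\<^sub>C A x)"
    and w0: "\<And>n. 0 \<le> w n" and w: "\<And>t. onorm (U t) \<le> exp (w \<lfloor>t\<rfloor>)"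
    and w_sum: "\<And>N::nat. (\<Sum>n\<in>{- int N..int N}. w n / (1 + (of_int n)\<^sup>2)) \<le> S"
    and x: "x \<in> C_infinity D A" "x \<noteq> 0" and growth: "\<And>k. norm ((A ^^ k) x) \<le> c * \<beta> ^ k"
    and \<beta>: "1 \<le> \<beta>"
  shows "norm ((A ^^ n) x) \<le> fact n * exp (12 * S + 128) * \<beta> ^ n * norm x"
proof -
  define a where "a k = \<i> ^ k *\<^sub>C (A ^^ k) x" for k
  have norm_a: "norm (a k) = norm ((A ^^ k) x)" for k
    by (simp add: a_def norm_scaleC norm_power)
  obtain \<psi> :: "'a \<Rightarrow> real" where psi: "bounded_linear \<psi>" "\<And>y. \<bar>\<psi> y\<bar> \<le> norm y"
    and norming: "\<psi> (a n) = norm (a n)"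
    by (rule norming_functional[of "a n"]) (rule that; assumption)
  define b where "b k = complex_of_real (\<psi> (a k))" for k
  have b: "cmod (b k) \<le> c * \<beta> ^ k" for k
    using psi(2)[of "a k"] growth[of k] norm_a[of k] by (simp add: b_def)
  define g where "g z = (\<Sum>k. b k / fact k * z ^ k)" for z
  have g_hol: "g holomorphic_on UNIV" and g_deriv: "(deriv ^^ n) g 0 = b n"
    using higher_deriv_exponential_series[of b, OF b] by (simp_all add: g_def[abs_def])
  have g_growth: "cmod (g z) \<le> c * exp (\<beta> * cmod z)" for z
    using summable_exponential_bounded_coeffs(2)[of b, OF b] by (simp add: g_def)
  have g_line: "cmod (g (of_real t)) \<le> norm x * exp (w \<lfloor>t\<rfloor>)" for t :: real
  proof -
    obtain N :: nat where N: "\<bar>t\<bar> \<le> real N" using real_arch_simple by blast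
    \<comment> \<open>The sum replaces the maximum of \<open>w\<close> over the finitely many intervals that meet \<open>[- \<bar>t\<bar>, \<bar>t\<bar>]\<close>.\<close>
    have bounded: "onorm (U s) \<le> exp (\<Sum>n\<in>{- int N..int N}. w n)" if "\<bar>s\<bar> \<le> \<bar>t\<bar>" for s
    proof -
      have "- real N \<le> s" "s \<le> real N" using that N by linarith+
      then have "\<lfloor>s\<rfloor> \<in> {- int N..int N}"
        using floor_mono[of s "real N"] by (simp add: le_floor_iff)
      then have "w \<lfloor>s\<rfloor> \<le> (\<Sum>n\<in>{- int N..int N}. w n)"
        using w0 by (intro member_le_sum) auto
      then show ?thesis using w[of s] by (meson exp_le_cancel_iff order_trans)
    qed
    have "(\<lambda>k. \<psi> (a k) / fact k * t ^ k) sums \<psi> (U t x)"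
      unfolding a_def
      by (rule orbit_exponential_series[OF U gen x(1) growth _ psi(1)]) (rule bounded)
    then have "(\<lambda>k. b k / fact k * of_real t ^ k) sums complex_of_real (\<psi> (U t x))"
      using sums_of_real[where 'a = complex] by (fastforce simp: b_def)
    then have "g (of_real t) = of_real (\<psi> (U t x))" by (simp add: g_def sums_iff)
    then have "cmod (g (of_real t)) \<le> norm (U t x)" using psi(2) by simp
    also have "\<dots> \<le> onorm (U t) * norm x"
      by (rule onorm[OF C0_group_bounded_linear[OF U]])
    also have "\<dots> \<le> exp (w \<lfloor>t\<rfloor>) * norm x" using w by (rule mult_right_mono) simp
    finally show ?thesis by (simp add: mult.commute)
  qed
  have "cmod ((deriv ^^ n) g 0) \<le> fact n * (norm x * exp (12 * S + 128)) / (1 / \<beta>) ^ n"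
  proof (rule Cauchy_inequality)
    show "g holomorphic_on ball 0 (1 / \<beta>)" "continuous_on (cball 0 (1 / \<beta>)) g"
      using g_hol by (auto intro: holomorphic_on_subset holomorphic_on_imp_continuous_on)
    show "cmod (g z) \<le> norm x * exp (12 * S + 128)" if "cmod (0 - z) = 1 / \<beta>" for z
      by (rule exponential_type_disc_bound[OF g_hol g_growth g_line w0 w_sum])
        (use x \<beta> that in auto)
  qed (use \<beta> in simp)
  also have "\<dots> = fact n * exp (12 * S + 128) * \<beta> ^ n * norm x"
    using \<beta> by (simp add: power_divide mult_ac)
  finally show ?thesis using norming by (simp add: g_deriv b_def norm_a)
qed

theorem theorem2:
  fixes U :: "real \<Rightarrow> 'a::complex_banach \<Rightarrow> 'a"
    and D :: "'a set"
    and A :: "'a \<Rightarrow> 'a"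
  assumes "clinear_op D A" and "closed_op D A" and "densely_defined D"
    and "C0_group U"
    and "is_generator U D (\<lambda>x. \<i> *\<^sub>C A x)"
    and "integrable lebesgue (\<lambda>t. ln (onorm (U t)) / (1 + t\<^sup>2))"
  shows "\<forall>n\<ge>1. \<exists>c>0. \<forall>\<alpha>\<ge>1. \<forall>x\<in>exp_type_vectors D A.
           exp_type D A x \<le> \<alpha> \<longrightarrow> norm ((A ^^ n) x) \<le> c * \<alpha> ^ n * norm x"
proof (cases "\<exists>y::'a. y \<noteq> 0")
  case False
  then have null: "norm z = 0" for z :: 'a by simp
  show ?thesis by (intro allI impI exI[of _ 1]) (simp add: null)
next
  case True
  then obtain y :: 'a where y: "y \<noteq> 0" by blast
  have A0: "(A ^^ n) 0 = 0" for n
  proof (induction n)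
    case (Suc n)
    have "0 \<in> D" "A (0 *\<^sub>C 0) = 0 *\<^sub>C A 0"
      using assms(1) by (auto simp: clinear_op_def)
    then have "A 0 = 0" by (metis norm_scaleC norm_eq_zero norm_zero mult_zero_left)
    then show ?case using Suc by simp
  qed simp
  note subadd = ln_onorm_C0_group_subadditive[OF assms(4) y]
  obtain w :: "int \<Rightarrow> real" and S where w0: "\<And>n. 0 \<le> w n"
    and ln_le: "\<And>t. ln (onorm (U t)) \<le> w \<lfloor>t\<rfloor>"
    and w_sum: "\<And>N::nat. (\<Sum>n\<in>{- int N..int N}. w n / (1 + (of_int n)\<^sup>2)) \<le> S"
    using subadditive_majorant[of "\<lambda>t. ln (onorm (U t))", OF subadd assms(6)] by blast
  have w: "onorm (U t) \<le> exp (w \<lfloor>t\<rfloor>)" for t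
    using ln_le[of t] C0_group_onorm_pos[OF assms(4) y, of t] by (metis exp_le_cancel_iff exp_ln)
  show ?thesis
  proof (intro allI impI)
    fix n :: nat
    \<comment> \<open>The factor \<open>2 ^ n\<close> is the price for \<open>\<beta> = 2 \<alpha>\<close>, a bound strictly above the type.\<close>
    let ?c = "fact n * exp (12 * S + 128) * 2 ^ n"
    have "norm ((A ^^ n) x) \<le> ?c * \<alpha> ^ n * norm x"
      if \<alpha>: "1 \<le> \<alpha>" and x: "x \<in> exp_type_vectors D A" "exp_type D A x \<le> \<alpha>" for \<alpha> x
    proof (cases "x = 0")
      case True then show ?thesis by (simp add: A0)
    next
      case False
      have "exp_type D A x < 2 * \<alpha>" using \<alpha> x(2) by simp
      then obtain c where "x \<in> C_infinity D A" "\<And>k. norm ((A ^^ k) x) \<le> c * (2 * \<alpha>) ^ k"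
        using exp_type_less_growth[OF x(1)] by metis
      then have "norm ((A ^^ n) x) \<le> fact n * exp (12 * S + 128) * (2 * \<alpha>) ^ n * norm x"
        using \<alpha> False by (intro norm_funpow_le[OF assms(4,5) w0 w w_sum]) auto
      then show ?thesis by (simp add: power_mult_distrib mult_ac)
    qed
    then show "\<exists>c>0. \<forall>\<alpha>\<ge>1. \<forall>x\<in>exp_type_vectors D A.
        exp_type D A x \<le> \<alpha> \<longrightarrow> norm ((A ^^ n) x) \<le> c * \<alpha> ^ n * norm x"
      by (intro exI[of _ ?c]) auto
  qed
qed

end
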